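(* For every integer $n\ge1$, the bivariate Laurent polynomial $$\tilde a_n(z_1,z_2)=4\bigl(\sigma(z_1)\sigma(z_2)\bigr)^{\lceil n/2\rceil}\bigl(\sigma(z_1)\sigma(z_2)-\delta(z_1)\delta(z_2)\bigr)^{\lfloor n/2\rfloor},$$ where $\sigma(z)=\frac{(1+z)^2}{4z}$ and $\delta(z)=-\frac{(1-z)^2}{4z}$, generates polynomials up to degree $2n-1$ and reproduces polynomials up to degree $1$.
   Context: A symbol is a bivariate Laurent polynomial $a(z_1,z_2)$ with real coefficients, regarded as a function of $(z_1,z_2)\in(\mathbb C\setminus\{0\})^2$. For $k=(k_1,k_2)\in\mathbb N_0^2$, $D^k=\partial_{z_1}^{k_1}\partial_{z_2}^{k_2}$ and $|k|=k_1+k_2$. Let $E'=\{(-1,1),(1,-1),(-1,-1)\}$. Generates polynomials up to degree $m$: $(D^k a)(z)=0$ for all $z\in E'$ and all $k\in\mathbb N_0^2$ with $0\le|k|\le m$. Reproduces polynomials up to degree $m'$ (for a symbol that generates polynomials up to some degree $m\ge m'$): $a(1,1)=4$ and $(D^k a)(1,1)=0$ for all $k\in\mathbb N_0^2$ with $0<|k|\le m'$. The symbol $\tilde a_n$ equals $4B_{\lceil n/2\rceil,\lceil n/2\rceil,\lfloor n/2\rfloor}$, where $$B_{i,j,k}(z_1,z_2)=\Bigl(\frac{(1+z_1)^2}{4z_1}\Bigr)^i\Bigl(\frac{(1+z_2)^2}{4z_2}\Bigr)^j\Bigl(\frac{(1+z_1z_2)(z_1+z_2)}{4z_1z_2}\Bigr)^k$$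 is the (normalized) symbol of a four-directional box-spline; note $\sigma(z_1)\sigma(z_2)-\delta(z_1)\delta(z_2)=\frac{(1+z_1z_2)(z_1+z_2)}{4z_1z_2}$. *)

theory Defs
  imports "HOL-Analysis.Analysis"
begin

(* Symbols are viewed as functions of (z1, z2) with z1, z2 nonzero; values at points
   with z1 = 0 or z2 = 0 are irrelevant, since the predicates below only look at germs
   at points with nonzero coordinates. *)
definition is_symbol :: "(complex \<times> complex \<Rightarrow> complex) \<Rightarrow> bool" where
  "is_symbol a \<longleftrightarrow>
     (\<exists>(S :: (int \<times> int) set) (c :: int \<times> int \<Rightarrow> real). finite S \<and>
        (\<forall>z1 z2. z1 \<noteq> 0 \<longrightarrow> z2 \<noteq> 0 \<longrightarrow>
           a (z1, z2) = (\<Sum>(i, j)\<in>S. of_real (c (i, j)) * z1 powi i * z2 powi j)))"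

definition partial1 :: "(complex \<times> complex \<Rightarrow> complex) \<Rightarrow> complex \<times> complex \<Rightarrow> complex" where
  "partial1 a = (\<lambda>(z1, z2). deriv (\<lambda>w. a (w, z2)) z1)"

definition partial2 :: "(complex \<times> complex \<Rightarrow> complex) \<Rightarrow> complex \<times> complex \<Rightarrow> complex" where
  "partial2 a = (\<lambda>(z1, z2). deriv (\<lambda>w. a (z1, w)) z2)"

definition mixed_partial ::
  "nat \<times> nat \<Rightarrow> (complex \<times> complex \<Rightarrow> complex) \<Rightarrow> complex \<times> complex \<Rightarrow> complex" where
  "mixed_partial k a = (partial1 ^^ fst k) ((partial2 ^^ snd k) a)"

definition E' :: "(complex \<times> complex) set" where
  "E' = {(-1, 1), (1, -1), (-1, -1)}"

definition generates_polynomials :: "nat \<Rightarrow> (complex \<times> complex \<Rightarrow> complex) \<Rightarrow> bool" where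
  "generates_polynomials m a \<longleftrightarrow>
     (\<forall>z\<in>E'. \<forall>k :: nat \<times> nat. fst k + snd k \<le> m \<longrightarrow> mixed_partial k a z = 0)"

(* Reproduction is only defined for symbols that generate polynomials up to some
   degree at least m; this requirement is made part of the predicate. *)
definition reproduces_polynomials :: "nat \<Rightarrow> (complex \<times> complex \<Rightarrow> complex) \<Rightarrow> bool" where
  "reproduces_polynomials m a \<longleftrightarrow>
     (\<exists>m'\<ge>m. generates_polynomials m' a) \<and> a (1, 1) = 4 \<and>
     (\<forall>k :: nat \<times> nat. 0 < fst k + snd k \<and> fst k + snd k \<le> m \<longrightarrow>
        mixed_partial k a (1, 1) = 0)"

definition symb_sigma :: "complex \<Rightarrow> complex" where
  "symb_sigma z = (1 + z)\<^sup>2 / (4 * z)"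

definition symb_delta :: "complex \<Rightarrow> complex" where
  "symb_delta z = - ((1 - z)\<^sup>2 / (4 * z))"

definition a_tilde :: "nat \<Rightarrow> complex \<times> complex \<Rightarrow> complex" where
  "a_tilde n = (\<lambda>(z1, z2).
     4 * (symb_sigma z1 * symb_sigma z2) ^ nat \<lceil>real n / 2\<rceil> *
     (symb_sigma z1 * symb_sigma z2 - symb_delta z1 * symb_delta z2) ^ nat \<lfloor>real n / 2\<rfloor>)"

end

theory Submission
  imports Defs "HOL-Complex_Analysis.Cauchy_Integral_Formula"
begin

text \<open>
  Say that a symbol vanishes to order \<open>m\<close> at \<open>p\<close> if it and its derivatives of order less than \<open>m\<close>
  vanish at \<open>p\<close>. By the Leibniz rule, orders add up under multiplication. At \<open>(-1, 1)\<close> and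
  \<open>(1, -1)\<close> both \<open>\<sigma>(z\<^sub>1) \<sigma>(z\<^sub>2)\<close> and
  \<open>\<sigma>(z\<^sub>1) \<sigma>(z\<^sub>2) - \<delta>(z\<^sub>1) \<delta>(z\<^sub>2) = (1 + z\<^sub>1 z\<^sub>2) (z\<^sub>1 + z\<^sub>2) / (4 z\<^sub>1 z\<^sub>2)\<close> vanish to order 2, which
  gives order \<open>2 (\<lceil>n/2\<rceil> + \<lfloor>n/2\<rfloor>) = 2 n\<close> in total; at \<open>(-1, -1)\<close> the first factor alone vanishes to
  order 4, which gives \<open>4 \<lceil>n/2\<rceil> \<ge> 2 n\<close>. For reproduction, \<open>\<sigma>(1) = 1\<close> and \<open>\<delta>(1) = 0\<close>, so on the
  lines \<open>z\<^sub>2 = 1\<close> and \<open>z\<^sub>1 = 1\<close> the symbol is \<open>4 \<sigma>\<^sup>n\<close>, and \<open>\<sigma>'(1) = 0\<close>.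
\<close>

lemma higher_deriv_sum:
  fixes f :: "'i \<Rightarrow> complex \<Rightarrow> complex"
  assumes "\<And>i. i \<in> I \<Longrightarrow> f i holomorphic_on S" "open S" "z \<in> S"
  shows "(deriv ^^ n) (\<lambda>w. \<Sum>i\<in>I. f i w) z = (\<Sum>i\<in>I. (deriv ^^ n) (f i) z)"
  using assms(1)
proof (induction I rule: infinite_finite_induct)
  case (insert i I)
  have "(deriv ^^ n) (\<lambda>w. f i w + (\<Sum>i\<in>I. f i w)) z =
      (deriv ^^ n) (f i) z + (deriv ^^ n) (\<lambda>w. \<Sum>i\<in>I. f i w) z"
    using insert.prems assms(2,3) by (intro higher_deriv_add holomorphic_intros) auto
  then show ?case using insert by simp
qed simp_all

section \<open>Symbols\<close>

definition torus :: "(complex \<times> complex) set" where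
  "torus = (- {0}) \<times> (- {0})"

definition laurent_monom :: "int \<times> int \<Rightarrow> complex \<times> complex \<Rightarrow> complex" where
  "laurent_monom k z = fst z powi fst k * snd z powi snd k"

lemma mem_torus_iff [simp]: "(z1, z2) \<in> torus \<longleftrightarrow> z1 \<noteq> 0 \<and> z2 \<noteq> 0"
  by (simp add: torus_def)

lemma laurent_monom_add:
  "z \<in> torus \<Longrightarrow> laurent_monom (k + l) z = laurent_monom k z * laurent_monom l z"
  by (cases z) (simp add: laurent_monom_def power_int_add)

lemma is_symbol_iff:
  "is_symbol a \<longleftrightarrow> (\<exists>(S :: (int \<times> int) set) c. finite S \<and>
     (\<forall>z\<in>torus. a z = (\<Sum>k\<in>S. of_real (c k) * laurent_monom k z)))"
  by (simp add: is_symbol_def torus_def laurent_monom_def case_prod_unfold mult.assoc Ball_def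
      imp_conjL)

lemma is_symbolE:
  assumes "is_symbol a"
  obtains S :: "(int \<times> int) set" and c where "finite S"
    and "\<And>z. z \<in> torus \<Longrightarrow> a z = (\<Sum>k\<in>S. of_real (c k) * laurent_monom k z)"
  using assms unfolding is_symbol_iff by blast

lemma is_symbolI:
  fixes e :: "'i \<Rightarrow> int \<times> int"
  assumes "finite I"
    and a: "\<And>z. z \<in> torus \<Longrightarrow> a z = (\<Sum>i\<in>I. of_real (c i) * laurent_monom (e i) z)"
  shows "is_symbol a"
proof -
  define d where "d k = (\<Sum>i | i \<in> I \<and> e i = k. c i)" for k
  have "a z = (\<Sum>k\<in>e ` I. of_real (d k) * laurent_monom k z)" if "z \<in> torus" for z
  proof -
    have "a z = (\<Sum>k\<in>e ` I. \<Sum>i | i \<in> I \<and> e i = k. of_real (c i) * laurent_monom (e i) z)"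
      unfolding a[OF that] by (rule sum.image_gen[OF assms(1)])
    also have "\<dots> = (\<Sum>k\<in>e ` I. of_real (d k) * laurent_monom k z)"
      by (simp add: d_def sum_distrib_right)
    finally show ?thesis .
  qed
  then show ?thesis
    unfolding is_symbol_iff using assms(1) by blast
qed

lemma is_symbol_monom: "is_symbol (\<lambda>z. of_real c * laurent_monom k z)"
  by (rule is_symbolI[of "{()}" _ "\<lambda>_. c" "\<lambda>_. k"]) simp_all

lemma is_symbol_const: "is_symbol (\<lambda>z. of_real c)"
  using is_symbol_monom[of c 0] by (simp add: laurent_monom_def)

lemma is_symbol_1: "is_symbol (\<lambda>z. 1)"
  using is_symbol_const[of 1] by simp

lemma is_symbol_coordinates:
  shows is_symbol_fst: "is_symbol (\<lambda>z. fst z)"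
    and is_symbol_snd: "is_symbol (\<lambda>z. snd z)"
    and is_symbol_inverse_fst: "is_symbol (\<lambda>z. inverse (fst z))"
    and is_symbol_inverse_snd: "is_symbol (\<lambda>z. inverse (snd z))"
  using is_symbol_monom[of 1 "(1, 0)"] is_symbol_monom[of 1 "(0, 1)"]
    is_symbol_monom[of 1 "(- 1, 0)"] is_symbol_monom[of 1 "(0, - 1)"]
  by (simp_all add: laurent_monom_def power_int_minus)

lemma is_symbol_add:
  assumes "is_symbol f" "is_symbol g"
  shows "is_symbol (\<lambda>z. f z + g z)"
proof -
  obtain S c where f_sum: "finite S"
    "\<And>z. z \<in> torus \<Longrightarrow> f z = (\<Sum>k\<in>S. of_real (c k) * laurent_monom k z)"
    using is_symbolE[OF assms(1)] by blast
  obtain T d where g_sum: "finite T"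
    "\<And>z. z \<in> torus \<Longrightarrow> g z = (\<Sum>k\<in>T. of_real (d k) * laurent_monom k z)"
    using is_symbolE[OF assms(2)] by blast
  show ?thesis
    by (rule is_symbolI[of "S <+> T" _ "case_sum c d" "case_sum id id"])
      (simp_all add: f_sum g_sum sum.Plus)
qed

lemma is_symbol_mult:
  assumes "is_symbol f" "is_symbol g"
  shows "is_symbol (\<lambda>z. f z * g z)"
proof -
  obtain S c where f_sum: "finite S"
    "\<And>z. z \<in> torus \<Longrightarrow> f z = (\<Sum>k\<in>S. of_real (c k) * laurent_monom k z)"
    using is_symbolE[OF assms(1)] by blast
  obtain T d where g_sum: "finite T"
    "\<And>z. z \<in> torus \<Longrightarrow> g z = (\<Sum>k\<in>T. of_real (d k) * laurent_monom k z)"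
    using is_symbolE[OF assms(2)] by blast
  show ?thesis
    by (rule is_symbolI[of "S \<times> T" _ "\<lambda>(k, l). c k * d l" "\<lambda>(k, l). k + l"])
      (simp_all add: f_sum g_sum sum_product sum.cartesian_product case_prod_unfold
        laurent_monom_add mult_ac)
qed

lemmas is_symbol_intros =
  is_symbol_1 is_symbol_const is_symbol_coordinates is_symbol_add is_symbol_mult

lemma has_field_derivative_laurent_monom_snd:
  assumes "(z1, z2) \<in> torus"
  shows "((\<lambda>w. laurent_monom k (z1, w)) has_field_derivative
           of_int (snd k) * laurent_monom (k - (0, 1)) (z1, z2)) (at z2)"
  using assms unfolding laurent_monom_def by (auto intro!: derivative_eq_intros)

lemma is_symbol_partial2:
  assumes "is_symbol f"
  shows "is_symbol (partial2 f)"
proof -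
  obtain S c where "finite S" and
    f: "\<And>z. z \<in> torus \<Longrightarrow> f z = (\<Sum>k\<in>S. of_real (c k) * laurent_monom k z)"
    using is_symbolE[OF assms] by blast
  show ?thesis
  proof (rule is_symbolI[OF \<open>finite S\<close>])
    fix z assume "z \<in> torus"
    then obtain z1 z2 where z: "z = (z1, z2)" and nonzero: "z1 \<noteq> 0" "z2 \<noteq> 0" by (cases z) auto
    have "((\<lambda>w. \<Sum>k\<in>S. of_real (c k) * laurent_monom k (z1, w)) has_field_derivative
        (\<Sum>k\<in>S. of_real (c k) * (of_int (snd k) * laurent_monom (k - (0, 1)) z))) (at z2)"
      unfolding z using nonzero
      by (intro DERIV_sum DERIV_cmult has_field_derivative_laurent_monom_snd) simp
    then have "((\<lambda>w. f (z1, w)) has_field_derivative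
        (\<Sum>k\<in>S. of_real (c k) * (of_int (snd k) * laurent_monom (k - (0, 1)) z))) (at z2)"
      by (rule has_field_derivative_transform_within_open[of _ _ _ "- {0}"])
        (use nonzero in \<open>auto simp: f\<close>)
    then show "partial2 f z =
        (\<Sum>k\<in>S. of_real (c k * of_int (snd k)) * laurent_monom (k - (0, 1)) z)"
      by (simp add: z partial2_def DERIV_imp_deriv mult.assoc)
  qed
qed

lemma is_symbol_funpow_partial2: "is_symbol f \<Longrightarrow> is_symbol ((partial2 ^^ n) f)"
  by (induction n) (simp_all add: is_symbol_partial2)

lemma holomorphic_on_symbol_compose:
  assumes "is_symbol f" "u holomorphic_on A" "v holomorphic_on A"
    and uv: "\<And>w. w \<in> A \<Longrightarrow> (u w, v w) \<in> torus"
  shows "(\<lambda>w. f (u w, v w)) holomorphic_on A"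
proof -
  obtain S c where "\<And>z. z \<in> torus \<Longrightarrow> f z = (\<Sum>k\<in>S. of_real (c k) * laurent_monom k z)"
    using is_symbolE[OF assms(1)] by blast
  then have "(\<lambda>w. f (u w, v w)) holomorphic_on A \<longleftrightarrow>
      (\<lambda>w. \<Sum>k\<in>S. of_real (c k) * laurent_monom k (u w, v w)) holomorphic_on A"
    using uv by (intro holomorphic_cong) auto
  also have \<dots>
    using uv unfolding laurent_monom_def by (auto intro!: holomorphic_intros assms(2,3))
  finally show ?thesis .
qed

section \<open>The Leibniz rule and orders of vanishing\<close>

lemma funpow_partial1: "(partial1 ^^ n) f (z1, z2) = (deriv ^^ n) (\<lambda>w. f (w, z2)) z1"
  by (induction n arbitrary: z1) (simp_all add: partial1_def)

lemma funpow_partial2: "(partial2 ^^ n) f (z1, z2) = (deriv ^^ n) (\<lambda>w. f (z1, w)) z2"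
  by (induction n arbitrary: z2) (simp_all add: partial2_def)

lemma mixed_partial_eq_funpow_deriv:
  "mixed_partial (i, j) f (z1, z2) = (deriv ^^ i) (\<lambda>w. (partial2 ^^ j) f (w, z2)) z1"
  by (simp add: mixed_partial_def funpow_partial1)

lemma funpow_partial2_mult:
  assumes "is_symbol f" "is_symbol g" "(z1, z2) \<in> torus"
  shows "(partial2 ^^ n) (\<lambda>z. f z * g z) (z1, z2) =
    (\<Sum>j = 0..n. of_nat (n choose j) *
      ((partial2 ^^ j) f (z1, z2) * (partial2 ^^ (n - j)) g (z1, z2)))"
proof -
  have holomorphic: "(\<lambda>w. h (z1, w)) holomorphic_on - {0}" if "is_symbol h" for h
    using assms(3) by (intro holomorphic_on_symbol_compose that holomorphic_intros) auto
  have "open (- {0 :: complex})" "z2 \<in> - {0}" using assms(3) by auto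
  from higher_deriv_mult[OF holomorphic[OF assms(1)] holomorphic[OF assms(2)] this, of n]
  show ?thesis by (simp add: funpow_partial2 mult.assoc)
qed

lemma mixed_partial_mult:
  assumes f: "is_symbol f" and g: "is_symbol g" and "(z1, z2) \<in> torus"
  shows "mixed_partial (m, n) (\<lambda>z. f z * g z) (z1, z2) =
    (\<Sum>j = 0..n. \<Sum>i = 0..m. of_nat ((n choose j) * (m choose i)) *
      (mixed_partial (i, j) f (z1, z2) * mixed_partial (m - i, n - j) g (z1, z2)))"
proof -
  define F where "F j w = (partial2 ^^ j) f (w, z2)" for j w
  define G where "G j w = (partial2 ^^ j) g (w, z2)" for j w
  have nonzero: "z1 \<in> - {0}" "z2 \<noteq> 0" using assms(3) by auto
  have holomorphic_FG: "F j holomorphic_on - {0}" "G j holomorphic_on - {0}" for j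
    unfolding F_def G_def using nonzero
    by (auto intro!: holomorphic_on_symbol_compose is_symbol_funpow_partial2 f g
        holomorphic_intros)
  have "eventually (\<lambda>w. w \<in> - {0}) (nhds z1)"
    by (rule eventually_nhds_in_open) (use nonzero in auto)
  then have "eventually (\<lambda>w. (partial2 ^^ n) (\<lambda>z. f z * g z) (w, z2) =
      (\<Sum>j = 0..n. of_nat (n choose j) * (F j w * G (n - j) w))) (nhds z1)"
    unfolding F_def G_def
    by eventually_elim (use nonzero in \<open>simp add: funpow_partial2_mult f g\<close>)
  then have "mixed_partial (m, n) (\<lambda>z. f z * g z) (z1, z2) =
      (deriv ^^ m) (\<lambda>w. \<Sum>j = 0..n. of_nat (n choose j) * (F j w * G (n - j) w)) z1"
    unfolding mixed_partial_eq_funpow_deriv by (rule higher_deriv_cong_ev) simp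
  also have "\<dots> = (\<Sum>j = 0..n. (deriv ^^ m) (\<lambda>w. of_nat (n choose j) * (F j w * G (n - j) w)) z1)"
    by (rule higher_deriv_sum[of _ _ "- {0}"])
      (use nonzero in \<open>auto intro!: holomorphic_intros holomorphic_FG\<close>)
  also have "\<dots> = (\<Sum>j = 0..n. of_nat (n choose j) * (deriv ^^ m) (\<lambda>w. F j w * G (n - j) w) z1)"
    by (intro sum.cong refl higher_deriv_cmult[of _ "- {0}"])
      (use nonzero in \<open>auto intro!: holomorphic_intros holomorphic_FG\<close>)
  also have "\<dots> = (\<Sum>j = 0..n. of_nat (n choose j) * (\<Sum>i = 0..m. of_nat (m choose i) *
      (deriv ^^ i) (F j) z1 * (deriv ^^ (m - i)) (G (n - j)) z1))"
    by (intro sum.cong refl arg_cong2[of _ _ _ _ "(*)"] higher_deriv_mult[of _ "- {0}"] holomorphic_FG)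
      (use nonzero in auto)
  finally show ?thesis
    unfolding mixed_partial_eq_funpow_deriv F_def G_def by (simp add: sum_distrib_left mult.assoc)
qed

definition vanishes_to_order ::
  "complex \<times> complex \<Rightarrow> nat \<Rightarrow> (complex \<times> complex \<Rightarrow> complex) \<Rightarrow> bool" where
  "vanishes_to_order p m f \<longleftrightarrow>
     is_symbol f \<and> (\<forall>i j. i + j < m \<longrightarrow> mixed_partial (i, j) f p = 0)"

lemma generates_polynomialsI:
  assumes "\<And>p. p \<in> E' \<Longrightarrow> vanishes_to_order p (Suc m) f"
  shows "generates_polynomials m f"
  using assms unfolding generates_polynomials_def vanishes_to_order_def
  by (auto simp: less_Suc_eq_le)

lemma vanishes_to_order_0 [simp]: "vanishes_to_order p 0 f \<longleftrightarrow> is_symbol f"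
  by (simp add: vanishes_to_order_def)

lemma vanishes_to_order_1: "is_symbol f \<Longrightarrow> f p = 0 \<Longrightarrow> vanishes_to_order p 1 f"
  by (simp add: vanishes_to_order_def mixed_partial_def)

lemma vanishes_to_order_imp_is_symbol: "vanishes_to_order p m f \<Longrightarrow> is_symbol f"
  by (simp add: vanishes_to_order_def)

lemma vanishes_to_order_mono: "vanishes_to_order p m f \<Longrightarrow> k \<le> m \<Longrightarrow> vanishes_to_order p k f"
  by (auto simp: vanishes_to_order_def)

lemma vanishes_to_order_mult:
  assumes "p \<in> torus" and f: "vanishes_to_order p a f" and g: "vanishes_to_order p b g"
  shows "vanishes_to_order p (a + b) (\<lambda>z. f z * g z)"
  unfolding vanishes_to_order_def
proof (intro conjI allI impI)
  have symbols: "is_symbol f" "is_symbol g"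
    using f g by (auto dest: vanishes_to_order_imp_is_symbol)
  then show "is_symbol (\<lambda>z. f z * g z)" by (rule is_symbol_mult)
  fix m n assume order_less: "m + n < a + b"
  have summand: "mixed_partial (i, j) f p * mixed_partial (m - i, n - j) g p = 0"
    if "i \<le> m" "j \<le> n" for i j
  proof -
    have "i + j < a \<or> (m - i) + (n - j) < b"
      using order_less that by linarith
    then show ?thesis
      using f g by (auto simp: vanishes_to_order_def)
  qed
  have "mixed_partial (m, n) (\<lambda>z. f z * g z) p =
      (\<Sum>j = 0..n. \<Sum>i = 0..m. of_nat ((n choose j) * (m choose i)) *
        (mixed_partial (i, j) f p * mixed_partial (m - i, n - j) g p))"
    using mixed_partial_mult[OF symbols] assms(1) by (cases p) blast
  also have "\<dots> = 0"
    using summand by (intro sum.neutral ballI) simp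
  finally show "mixed_partial (m, n) (\<lambda>z. f z * g z) p = 0" .
qed

lemma vanishes_to_order_power:
  assumes "p \<in> torus" "vanishes_to_order p a f"
  shows "vanishes_to_order p (k * a) (\<lambda>z. f z ^ k)"
proof (induction k)
  case 0
  show ?case by (simp add: is_symbol_1)
next
  case (Suc k)
  then show ?case using vanishes_to_order_mult[OF assms Suc] by simp
qed

section \<open>The factors of the symbol\<close>

text \<open>
  The names refer to the directions of the box spline: \<open>1 + z\<^sub>1\<close> and \<open>1 + z\<^sub>2\<close> belong to the axes,
  \<open>1 + z\<^sub>1 z\<^sub>2\<close> and \<open>z\<^sub>1 + z\<^sub>2\<close> to the diagonals.
\<close>

definition axial_factor :: "complex \<times> complex \<Rightarrow> complex" where
  "axial_factor z = symb_sigma (fst z) * symb_sigma (snd z)"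

definition diagonal_factor :: "complex \<times> complex \<Rightarrow> complex" where
  "diagonal_factor z = axial_factor z - symb_delta (fst z) * symb_delta (snd z)"

lemma nat_floor_half: "nat \<lfloor>real n / 2\<rfloor> = n div 2"
  using floor_divide_of_nat_eq[of n 2, where 'a = real] by simp

lemma nat_ceiling_half: "nat \<lceil>real n / 2\<rceil> = (n + 1) div 2"
  using ceiling_divide_eq_div[of "int n" 2] by simp linarith

lemma a_tilde_eq:
  "a_tilde n = (\<lambda>z. 4 * (axial_factor z ^ ((n + 1) div 2) * diagonal_factor z ^ (n div 2)))"
  by (auto simp: a_tilde_def axial_factor_def diagonal_factor_def nat_floor_half nat_ceiling_half)

lemma diagonal_factor_eq:
  "diagonal_factor = (\<lambda>z.
     of_real (1/4) * inverse (fst z) * inverse (snd z) * ((1 + fst z * snd z) * (fst z + snd z)))"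
proof
  fix z
  show "diagonal_factor z =
      of_real (1/4) * inverse (fst z) * inverse (snd z) * ((1 + fst z * snd z) * (fst z + snd z))"
    by (cases "fst z = 0 \<or> snd z = 0")
      (auto simp: diagonal_factor_def axial_factor_def symb_sigma_def symb_delta_def field_simps
        power2_eq_square)
qed

lemma symb_sigma_eq: "symb_sigma w = of_real (1/4) * inverse w * (1 + w)\<^sup>2"
  by (simp add: symb_sigma_def field_simps)

lemma is_symbol_symb_sigma:
  assumes "is_symbol u" "is_symbol (\<lambda>z. inverse (u z))"
  shows "is_symbol (\<lambda>z. symb_sigma (u z))"
  unfolding symb_sigma_eq power2_eq_square
  by (intro is_symbol_intros assms)

lemma vanishes_to_order_symb_sigma:
  assumes p: "p \<in> torus" "u p = - 1" and u: "is_symbol u" "is_symbol (\<lambda>z. inverse (u z))"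
  shows "vanishes_to_order p 2 (\<lambda>z. symb_sigma (u z))"
proof -
  have "vanishes_to_order p 1 (\<lambda>z. 1 + u z)"
    by (intro vanishes_to_order_1 is_symbol_intros u) (simp add: p)
  from vanishes_to_order_power[OF p(1) this, of 2]
  have square: "vanishes_to_order p 2 (\<lambda>z. (1 + u z)\<^sup>2)" by simp
  have "vanishes_to_order p 0 (\<lambda>z. of_real (1/4) * inverse (u z))"
    unfolding vanishes_to_order_0 by (intro is_symbol_intros u)
  from vanishes_to_order_mult[OF p(1) this square] show ?thesis
    by (simp only: symb_sigma_eq add_0)
qed

lemmas is_symbol_symb_sigma_fst = is_symbol_symb_sigma[OF is_symbol_fst is_symbol_inverse_fst]
  and is_symbol_symb_sigma_snd = is_symbol_symb_sigma[OF is_symbol_snd is_symbol_inverse_snd]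

lemmas vanishes_to_order_symb_sigma_fst =
    vanishes_to_order_symb_sigma[OF _ _ is_symbol_fst is_symbol_inverse_fst]
  and vanishes_to_order_symb_sigma_snd =
    vanishes_to_order_symb_sigma[OF _ _ is_symbol_snd is_symbol_inverse_snd]

lemma is_symbol_diagonal_factor: "is_symbol diagonal_factor"
  unfolding diagonal_factor_eq by (intro is_symbol_intros)

lemma vanishes_to_order_axial_factor_corner: "vanishes_to_order (- 1, - 1) 4 axial_factor"
proof -
  have "vanishes_to_order (- 1, - 1) (2 + 2) axial_factor"
    unfolding axial_factor_def
    by (intro vanishes_to_order_mult vanishes_to_order_symb_sigma_fst
        vanishes_to_order_symb_sigma_snd) simp_all
  then show ?thesis by simp
qed

lemma vanishes_to_order_axial_factor:
  assumes "p \<in> torus" and "fst p = - 1 \<or> snd p = - 1"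
  shows "vanishes_to_order p 2 axial_factor"
  using assms(2)
proof
  assume "fst p = - 1"
  then have "vanishes_to_order p (2 + 0) axial_factor"
    unfolding axial_factor_def using assms(1)
    by (intro vanishes_to_order_mult vanishes_to_order_symb_sigma_fst)
      (simp_all add: is_symbol_symb_sigma_snd)
  then show ?thesis by (simp only: add_0_right)
next
  assume "snd p = - 1"
  then have "vanishes_to_order p (0 + 2) axial_factor"
    unfolding axial_factor_def using assms(1)
    by (intro vanishes_to_order_mult vanishes_to_order_symb_sigma_snd)
      (simp_all add: is_symbol_symb_sigma_fst)
  then show ?thesis by (simp only: add_0_left)
qed

lemma vanishes_to_order_diagonal_factor:
  assumes "p = (- 1, 1) \<or> p = (1, - 1)"
  shows "vanishes_to_order p 2 diagonal_factor"
proof -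
  have p: "p \<in> torus" using assms by auto
  have "vanishes_to_order p 1 (\<lambda>z. 1 + fst z * snd z)" "vanishes_to_order p 1 (\<lambda>z. fst z + snd z)"
    by (intro vanishes_to_order_1 is_symbol_intros; use assms in auto)+
  then have product: "vanishes_to_order p (1 + 1) (\<lambda>z. (1 + fst z * snd z) * (fst z + snd z))"
    by (rule vanishes_to_order_mult[OF p])
  have "vanishes_to_order p 0 (\<lambda>z. of_real (1/4) * inverse (fst z) * inverse (snd z))"
    unfolding vanishes_to_order_0 by (intro is_symbol_intros)
  from vanishes_to_order_mult[OF p this product] show ?thesis
    by (simp only: diagonal_factor_eq add_0 one_add_one)
qed

section \<open>Generation and reproduction\<close>

lemma vanishes_to_order_a_tilde:
  assumes p: "p \<in> torus"
    and "vanishes_to_order p a axial_factor" "vanishes_to_order p b diagonal_factor"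
  shows "vanishes_to_order p ((n + 1) div 2 * a + n div 2 * b) (a_tilde n)"
proof -
  have "vanishes_to_order p 0 (\<lambda>z. of_real 4)"
    unfolding vanishes_to_order_0 by (rule is_symbol_const)
  from vanishes_to_order_mult[OF p this vanishes_to_order_mult[OF p
      vanishes_to_order_power[OF p assms(2)] vanishes_to_order_power[OF p assms(3)]]]
  show ?thesis by (simp add: a_tilde_eq)
qed

lemma vanishes_to_order_a_tilde_E':
  assumes "p \<in> E'"
  shows "vanishes_to_order p (2 * n) (a_tilde n)"
proof -
  have p: "p \<in> torus" using assms by (auto simp: E'_def)
  consider (corner) "p = (- 1, - 1)" | (edge) "p = (- 1, 1) \<or> p = (1, - 1)"
    using assms by (auto simp: E'_def)
  then show ?thesis
  proof cases
    case corner
    have "vanishes_to_order p 0 diagonal_factor"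
      by (simp add: is_symbol_diagonal_factor)
    with vanishes_to_order_axial_factor_corner
    have "vanishes_to_order p ((n + 1) div 2 * 4 + n div 2 * 0) (a_tilde n)"
      unfolding corner by (intro vanishes_to_order_a_tilde) simp_all
    then show ?thesis by (rule vanishes_to_order_mono) presburger
  next
    case edge
    then have "vanishes_to_order p ((n + 1) div 2 * 2 + n div 2 * 2) (a_tilde n)"
      by (intro vanishes_to_order_a_tilde p vanishes_to_order_axial_factor
          vanishes_to_order_diagonal_factor) auto
    then show ?thesis by (rule vanishes_to_order_mono) presburger
  qed
qed

lemma is_symbol_a_tilde: "is_symbol (a_tilde n)"
  using vanishes_to_order_a_tilde_E'[of "(- 1, - 1)" n]
  by (simp add: E'_def vanishes_to_order_imp_is_symbol)

lemma generates_polynomials_a_tilde: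
  assumes "n \<ge> 1"
  shows "generates_polynomials (2 * n - 1) (a_tilde n)"
  using assms vanishes_to_order_a_tilde_E' by (intro generates_polynomialsI) simp

lemma a_tilde_line:
  shows "a_tilde n (w, 1) = 4 * symb_sigma w ^ n" and "a_tilde n (1, w) = 4 * symb_sigma w ^ n"
proof -
  have "symb_sigma 1 = 1" "symb_delta 1 = 0" "(n + 1) div 2 + n div 2 = n"
    by (simp_all add: symb_sigma_def symb_delta_def)
  then show "a_tilde n (w, 1) = 4 * symb_sigma w ^ n" "a_tilde n (1, w) = 4 * symb_sigma w ^ n"
    by (simp_all add: a_tilde_eq axial_factor_def diagonal_factor_def flip: power_add)
qed

lemma deriv_symb_sigma_power_1: "deriv (\<lambda>w. c * symb_sigma w ^ n) 1 = 0"
proof -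
  have "(symb_sigma has_field_derivative 0) (at 1)"
    unfolding symb_sigma_def by (auto intro!: derivative_eq_intros)
  then have "((\<lambda>w. c * symb_sigma w ^ n) has_field_derivative 0) (at 1)"
    by (auto intro!: derivative_eq_intros)
  then show ?thesis by (rule DERIV_imp_deriv)
qed

lemma reproduces_polynomials_a_tilde:
  assumes "n \<ge> 1"
  shows "reproduces_polynomials 1 (a_tilde n)"
  unfolding reproduces_polynomials_def
proof (intro conjI allI impI)
  show "\<exists>m'\<ge>1. generates_polynomials m' (a_tilde n)"
    using generates_polynomials_a_tilde[OF assms] assms by (intro exI[of _ "2 * n - 1"]) auto
  show "a_tilde n (1, 1) = 4"
    by (simp add: a_tilde_line symb_sigma_def)
  fix k :: "nat \<times> nat"
  assume "0 < fst k + snd k \<and> fst k + snd k \<le> 1"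
  then have "k = (1, 0) \<or> k = (0, 1)" by (cases k) auto
  then show "mixed_partial k (a_tilde n) (1, 1) = 0"
    by (auto simp: mixed_partial_def partial1_def partial2_def a_tilde_line
        deriv_symb_sigma_power_1)
qed

theorem proposition3p2:
  fixes n :: nat
  assumes "n \<ge> 1"
  shows "is_symbol (a_tilde n) \<and>
         generates_polynomials (2 * n - 1) (a_tilde n) \<and>
         reproduces_polynomials 1 (a_tilde n)"
  using assms is_symbol_a_tilde generates_polynomials_a_tilde reproduces_polynomials_a_tilde
  by blast

end
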